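(* For every odd positive integer $k=2m+1$ ($m\geq 1$), and every reflection symmetric point set $S$ with $|S|=k$, the Fermat-Weber point of $S$ coincides with the pivot of $S$ if and only if $S$ satisfies Condition A.
   Context: The Fermat-Weber point of a finite set $S=\{p_1,\dots,p_r\}$ of points in the plane $\mathbb{R}^2$ is the point $p\in\mathbb{R}^2$ minimizing $\sum_{i=1}^r d(p,p_i)$, where $d$ is the Euclidean distance; it is unique when the points of $S$ are not all collinear. A set $S$ of $k=2m+1$ ($m\ge 1$) points in the plane lying on the circumference of a unit circle with center $o$ is reflection symmetric if there exists a point $s_0\in S$ such that for every $s_i\in S\setminus\{s_0\}$, which lies in one of the two open halfplanes determined by the line $os_0$, the reflection $s_i'$ of $s_i$ about the line $os_0$ (lying in the other open halfplane) belongs to $S\setminus\{s_0,s_i\}$. The point $s_0$ is called the pivot of $S$ (a reflection symmetric set is considered together with its pivot). Choose rectangular coordinates with origin $o$ and horizontal axis along $os_0$, so that $s_0=(1,0)$; then $S=\{s_0,s_1,\dots,s_m,s_1',\dots,s_m'\}$ with $s_i=(\cos\theta_i,\sin\theta_i)$, $s_i'=(\cos\theta_i,-\sin\theta_i)$ and $0<\theta_i<\pi$ for $i=1,\dots,m$. The set $S$ satisfies Condition A if $2\sum_{i=1}^m\sin(\theta_i/2)-1\le 0$. *)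

theory Defs
  imports "HOL-Analysis.Analysis"
begin

definition dist_sum :: "(real^2) set \<Rightarrow> real^2 \<Rightarrow> real" where
  "dist_sum S p = (\<Sum>q\<in>S. dist p q)"

definition minimizes_dist_sum :: "(real^2) set \<Rightarrow> real^2 \<Rightarrow> bool" where
  "minimizes_dist_sum S p \<longleftrightarrow> (\<forall>q. dist_sum S p \<le> dist_sum S q)"

definition fermat_weber_point :: "(real^2) set \<Rightarrow> real^2" where
  "fermat_weber_point S = (THE p. minimizes_dist_sum S p)"

text \<open>The description above is proper for finite sets of non-collinear points.\<close>

lemma minimizes_dist_sum_ex1:
  assumes fin: "finite S" and nc: "\<not> collinear S"
  shows "\<exists>!p. minimizes_dist_sum S p"
proof (rule ex_ex1I)
  have "S \<noteq> {}" using nc by auto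
  then obtain s where s: "s \<in> S" by blast
  define K where "K = cball s (dist_sum S s)"
  have pos: "0 \<le> dist_sum S s" by (simp add: dist_sum_def sum_nonneg)
  have "continuous_on K (dist_sum S)"
    unfolding dist_sum_def by (intro continuous_intros)
  moreover have "compact K" "K \<noteq> {}" using pos by (auto simp: K_def)
  ultimately obtain p where p: "p \<in> K" "\<And>q. q \<in> K \<Longrightarrow> dist_sum S p \<le> dist_sum S q"
    using continuous_attains_inf[of K "dist_sum S"] by blast
  have "dist_sum S p \<le> dist_sum S q" for q
  proof (cases "q \<in> K")
    case False
    have "s \<in> K" using pos by (simp add: K_def)
    then have "dist_sum S p \<le> dist_sum S s" by (rule p(2))
    also have "\<dots> \<le> dist q s" using False by (simp add: K_def dist_commute)
    also have "\<dots> \<le> dist_sum S q"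
      unfolding dist_sum_def using fin s by (intro member_le_sum) auto
    finally show ?thesis .
  qed (use p in auto)
  then show "\<exists>p. minimizes_dist_sum S p" by (auto simp: minimizes_dist_sum_def)
next
  fix p q assume p: "minimizes_dist_sum S p" and q: "minimizes_dist_sum S q"
  show "p = q"
  proof (rule ccontr)
    assume ne: "p \<noteq> q"
    have eq: "dist_sum S p = dist_sum S q"
      using p q by (meson antisym minimizes_dist_sum_def)
    have half: "2 * norm (midpoint p q - s) = norm ((p - s) + (q - s))" for s
    proof -
      have "midpoint p q - s = (1/2) *\<^sub>R ((p - s) + (q - s))"
        by (simp add: midpoint_def vec_eq_iff field_simps)
      then show ?thesis by (simp add: dist_norm)
    qed
    have tri: "2 * dist (midpoint p q) s \<le> dist p s + dist q s" for s
      using norm_triangle_ineq[of "p - s" "q - s"] by (simp only: half dist_norm)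
    have "(\<Sum>s\<in>S. dist p s + dist q s) \<le> (\<Sum>s\<in>S. 2 * dist (midpoint p q) s)"
      using p eq unfolding minimizes_dist_sum_def dist_sum_def
      by (simp add: sum.distrib flip: sum_distrib_left)
    then have sums: "(\<Sum>s\<in>S. 2 * dist (midpoint p q) s) = (\<Sum>s\<in>S. dist p s + dist q s)"
      using sum_mono[of S "\<lambda>s. 2 * dist (midpoint p q) s" "\<lambda>s. dist p s + dist q s"] tri
      by fastforce
    have "s \<in> affine hull {p, q}" if "s \<in> S" for s
    proof -
      have "norm ((p - s) + (q - s)) = norm (p - s) + norm (q - s)"
        using sum_mono_inv[OF sums tri that fin] by (simp only: half dist_norm)
      then have par: "norm (p - s) *\<^sub>R (q - s) = norm (q - s) *\<^sub>R (p - s)"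
        by (simp only: norm_triangle_eq)
      define a b where "a = norm (p - s)" and "b = norm (q - s)"
      have par': "a *\<^sub>R (q - s) = b *\<^sub>R (p - s)" using par by (simp add: a_def b_def)
      have ab: "a \<noteq> b"
      proof
        assume "a = b"
        with par' have "a *\<^sub>R (q - p) = 0" by (simp add: algebra_simps)
        then have "a = 0" using ne by simp
        with \<open>a = b\<close> show False using ne by (simp add: a_def b_def)
      qed
      have "(a - b) *\<^sub>R s = a *\<^sub>R q - b *\<^sub>R p" using par' by (simp add: algebra_simps)
      then have "(1 / (a - b)) *\<^sub>R (a - b) *\<^sub>R s = (1 / (a - b)) *\<^sub>R (a *\<^sub>R q - b *\<^sub>R p)"
        by simp
      then have "s = (- b / (a - b)) *\<^sub>R p + (a / (a - b)) *\<^sub>R q"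
        using ab by (simp add: scaleR_diff_right)
      moreover have "- b / (a - b) + a / (a - b) = 1" using ab by (simp flip: diff_divide_distrib)
      ultimately show ?thesis unfolding affine_hull_2 by blast
    qed
    then have "collinear S" unfolding collinear_affine_hull by blast
    with nc show False ..
  qed
qed

definition reflect_about_line :: "real^2 \<Rightarrow> real^2 \<Rightarrow> real^2 \<Rightarrow> real^2" where
  "reflect_about_line a b p =
     a + (2 * ((p - a) \<bullet> (b - a)) / ((b - a) \<bullet> (b - a))) *\<^sub>R (b - a) - (p - a)"

text \<open>The union of the two open halfplanes determined by a line is the complement of the line.
  A set may have several pivots, so the pivot is an argument.\<close>

definition reflection_symmetric :: "real^2 \<Rightarrow> (real^2) set \<Rightarrow> real^2 \<Rightarrow> bool" where
  "reflection_symmetric c S s0 \<longleftrightarrow>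
     S \<subseteq> sphere c 1 \<and> s0 \<in> S \<and>
     (\<forall>s\<in>S - {s0}. s \<notin> affine hull {c, s0} \<and> reflect_about_line c s0 s \<in> S - {s0, s})"

definition rot90 :: "real^2 \<Rightarrow> real^2" where
  "rot90 u = vector [- u $ 2, u $ 1]"

text \<open>If \<open>dist c s0 = 1\<close>, this is the point with coordinates \<open>(cos \<theta>, sin \<theta>)\<close> in the
  rectangular coordinate system with origin \<open>c\<close> in which \<open>s0 = (1, 0)\<close>.\<close>

definition circle_point :: "real^2 \<Rightarrow> real^2 \<Rightarrow> real \<Rightarrow> real^2" where
  "circle_point c s0 \<theta> = c + cos \<theta> *\<^sub>R (s0 - c) + sin \<theta> *\<^sub>R rot90 (s0 - c)"

text \<open>For a reflection symmetric set these are the angles \<open>\<theta>\<^sub>1, \<dots>, \<theta>\<^sub>m\<close>; distinct points have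
  distinct angles, so no multiplicities are lost.\<close>

definition upper_angles :: "real^2 \<Rightarrow> (real^2) set \<Rightarrow> real^2 \<Rightarrow> real set" where
  "upper_angles c S s0 = {\<theta>. 0 < \<theta> \<and> \<theta> < pi \<and> circle_point c s0 \<theta> \<in> S}"

definition condition_A :: "real^2 \<Rightarrow> (real^2) set \<Rightarrow> real^2 \<Rightarrow> bool" where
  "condition_A c S s0 \<longleftrightarrow> 2 * (\<Sum>\<theta>\<in>upper_angles c S s0. sin (\<theta> / 2)) - 1 \<le> 0"

lemma circle_point_coords:
  assumes "dist c s0 = 1"
  shows "(circle_point c s0 \<theta> - c) \<bullet> (s0 - c) = cos \<theta>"
    and "(circle_point c s0 \<theta> - c) \<bullet> rot90 (s0 - c) = sin \<theta>"
proof -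
  have n: "(s0 - c) \<bullet> (s0 - c) = 1"
    using assms by (simp add: dist_norm norm_minus_commute dot_square_norm)
  have o: "rot90 (s0 - c) \<bullet> (s0 - c) = 0" "(s0 - c) \<bullet> rot90 (s0 - c) = 0"
    and r: "rot90 (s0 - c) \<bullet> rot90 (s0 - c) = (s0 - c) \<bullet> (s0 - c)"
    by (simp_all add: rot90_def inner_vec_def sum_2 algebra_simps)
  show "(circle_point c s0 \<theta> - c) \<bullet> (s0 - c) = cos \<theta>"
    "(circle_point c s0 \<theta> - c) \<bullet> rot90 (s0 - c) = sin \<theta>"
    using n o r by (simp_all add: circle_point_def inner_add_left)
qed

lemma condition_A_enumeration:
  assumes c: "dist c s0 = 1"
    and th: "\<And>i. i \<in> {1..m} \<Longrightarrow> 0 < \<theta> i \<and> \<theta> i < pi"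
    and inj: "inj_on \<theta> {1..m}"
    and S: "S = {s0} \<union> (\<lambda>i. circle_point c s0 (\<theta> i)) ` {1..m}
                     \<union> (\<lambda>i. circle_point c s0 (- \<theta> i)) ` {1..m}"
  shows "condition_A c S s0 \<longleftrightarrow> 2 * (\<Sum>i = 1..m. sin (\<theta> i / 2)) - 1 \<le> 0"
proof -
  have "upper_angles c S s0 = \<theta> ` {1..m}"
  proof (intro equalityI subsetI)
    fix t assume "t \<in> upper_angles c S s0"
    then have t: "0 < t" "t < pi" and tS: "circle_point c s0 t \<in> S"
      by (auto simp: upper_angles_def)
    have pos: "sin t > 0" using t by (rule sin_gt_zero)
    have s0: "circle_point c s0 0 = s0" by (simp add: circle_point_def)
    from tS consider "circle_point c s0 t = circle_point c s0 0"
      | i where "i \<in> {1..m}" "circle_point c s0 t = circle_point c s0 (\<theta> i)"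
      | i where "i \<in> {1..m}" "circle_point c s0 t = circle_point c s0 (- \<theta> i)"
      unfolding S s0 by blast
    then show "t \<in> \<theta> ` {1..m}"
    proof cases
      case 1
      then have "sin t = sin 0" by (metis circle_point_coords(2)[OF c])
      with pos show ?thesis by simp
    next
      case 2
      then have "cos t = cos (\<theta> i)" by (metis circle_point_coords(1)[OF c])
      then have "t = \<theta> i" using t th[OF 2(1)] by (simp add: cos_inj_pi)
      with 2 show ?thesis by blast
    next
      case 3
      then have "sin t = sin (- \<theta> i)" by (metis circle_point_coords(2)[OF c])
      moreover have "sin (\<theta> i) > 0" using th[OF 3(1)] by (intro sin_gt_zero) auto
      ultimately show ?thesis using pos by simp
    qed
  qed (use th S in \<open>auto simp: upper_angles_def\<close>)
  then show ?thesis using inj by (simp add: condition_A_def sum.reindex)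
qed

end

theory Submission
  imports Defs
begin

text \<open>
  The sum of distances is convex, and at a point \<open>p\<close> of the set the summand of \<open>p\<close> itself has a
  corner whose subgradients are all vectors of norm at most one. Hence \<open>p\<close> is a minimizer
  exactly when the unit vectors from \<open>p\<close> towards the remaining points, which are minus the
  gradients of the remaining summands, add up to a vector of norm at most one
  (\<open>sum_dist_minimal_at_point_iff\<close>).

  For a reflection symmetric set and its pivot this sum is explicit. Seen from the pivot, the point
  at angle \<open>\<theta>\<close> lies in a direction with component \<open>- sin (\<theta> / 2)\<close> along the axis and component
  \<open>cos (\<theta> / 2)\<close> across it (\<open>sgn_circle_point_diff\<close>). In a mirror pair the components across
  the axis cancel, so all that remains is the axis vector times
  \<open>- 2 * (\<Sum>\<theta>. sin (\<theta> / 2))\<close>, summed over the angles in the upper halfplane. Its norm is at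
  most one exactly if Condition A holds. The pivot and a mirror pair are never collinear, so the
  Fermat-Weber point is unique and "the minimizer is the pivot" says the same as "the pivot is a
  minimizer".
\<close>

section \<open>Minimality of the sum of distances at a point of the set\<close>

text \<open>For \<open>s \<noteq> p\<close> the distance to \<open>s\<close> lies above its linearization at \<open>p\<close>, whose slope is
  \<open>sgn (p - s)\<close>; this gives sufficiency without any limit argument. For necessity, let \<open>V\<close> be
  the sum of unit vectors: moving from \<open>p\<close> in the direction \<open>V\<close> changes the total distance at
  the initial rate \<open>norm V - (norm V)\<^sup>2\<close>, which is negative as soon as \<open>norm V > 1\<close>.\<close>

lemma sum_dist_minimal_at_point_iff:
  fixes S :: "'a::real_inner set"
  assumes fin: "finite S" and pS: "p \<in> S"
  shows "(\<forall>q. (\<Sum>s\<in>S. dist p s) \<le> (\<Sum>s\<in>S. dist q s))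
           \<longleftrightarrow> norm (\<Sum>s\<in>S - {p}. sgn (s - p)) \<le> 1"
proof -
  define T where "T = S - {p}"
  define V where "V = (\<Sum>s\<in>T. sgn (s - p))"
  have total: "(\<Sum>s\<in>S. dist q s) = norm (q - p) + (\<Sum>s\<in>T. norm (q - s))" for q
    using fin pS by (simp add: T_def sum.remove[OF fin pS] dist_norm)
  have sumV: "(\<Sum>s\<in>T. w \<bullet> sgn (p - s)) = - (w \<bullet> V)" for w
  proof -
    have "sgn (p - s) = - sgn (s - p)" for s
      by (metis minus_diff_eq sgn_minus)
    then show ?thesis by (simp add: V_def inner_sum_right sum_negf)
  qed
  have "norm V \<le> 1" if min: "\<forall>q. (\<Sum>s\<in>S. dist p s) \<le> (\<Sum>s\<in>S. dist q s)"
  proof (rule ccontr)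
    assume "\<not> norm V \<le> 1"
    then have V1: "1 < norm V" by simp
    define g where "g t = t * norm V + (\<Sum>s\<in>T. norm (p + t *\<^sub>R V - s))" for t
    have "((\<lambda>t. norm (p + t *\<^sub>R V - s)) has_real_derivative V \<bullet> sgn (p - s)) (at 0)"
      if "s \<in> T" for s
    proof -
      have nz: "p + 0 *\<^sub>R V - s \<noteq> 0" using that by (auto simp: T_def)
      have "((\<lambda>t. p + t *\<^sub>R V - s) has_derivative (\<lambda>t. t *\<^sub>R V)) (at 0)"
        by (auto intro!: derivative_eq_intros)
      from has_derivative_compose[OF this has_derivative_norm[OF nz]]
      show ?thesis
        by (simp add: has_field_derivative_def inner_commute mult_commute_abs)
    qed
    then have "(g has_real_derivative norm V + (\<Sum>s\<in>T. V \<bullet> sgn (p - s))) (at 0)"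
      unfolding g_def by (auto intro!: derivative_eq_intros)
    moreover have "norm V + (\<Sum>s\<in>T. V \<bullet> sgn (p - s)) < 0"
    proof -
      have "norm V * 1 < norm V * norm V" using V1 by (intro mult_strict_left_mono) auto
      then show ?thesis by (simp add: sumV dot_square_norm power2_eq_square)
    qed
    ultimately obtain d where d: "0 < d" "\<And>h. 0 < h \<Longrightarrow> h < d \<Longrightarrow> g (0 + h) < g 0"
      using DERIV_neg_dec_right by blast
    have "g (d / 2) < g 0" using d(1) d(2)[of "d / 2"] by simp
    moreover have "g 0 = (\<Sum>s\<in>S. dist p s)" by (simp add: g_def total)
    moreover have "g (d / 2) = (\<Sum>s\<in>S. dist (p + (d / 2) *\<^sub>R V) s)"
      using d(1) by (simp add: g_def total)
    ultimately show False using min by (metis not_le)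
  qed
  moreover have "(\<Sum>s\<in>S. dist p s) \<le> (\<Sum>s\<in>S. dist q s)" if V1: "norm V \<le> 1" for q
  proof -
    have "norm (p - s) + (q - p) \<bullet> sgn (p - s) \<le> norm (q - s)" for s
    proof -
      have "norm (p - s) + (q - p) \<bullet> sgn (p - s) = (q - s) \<bullet> sgn (p - s)"
      proof -
        have "(p - s) \<bullet> sgn (p - s) = norm (p - s)"
          by (cases "p = s") (simp_all add: sgn_div_norm dot_square_norm power2_eq_square)
        then show ?thesis by (metis add.commute diff_add_cancel add_diff_eq inner_add_left)
      qed
      also have "\<dots> \<le> norm (q - s) * norm (sgn (p - s))" by (rule norm_cauchy_schwarz)
      also have "\<dots> \<le> norm (q - s)" by (simp add: norm_sgn)
      finally show ?thesis .
    qed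
    then have "(\<Sum>s\<in>T. norm (p - s)) + (\<Sum>s\<in>T. (q - p) \<bullet> sgn (p - s)) \<le> (\<Sum>s\<in>T. norm (q - s))"
      by (simp add: sum_mono flip: sum.distrib)
    moreover have "(q - p) \<bullet> V \<le> norm (q - p)"
      using norm_cauchy_schwarz[of "q - p" V] mult_left_mono[OF V1, of "norm (q - p)"] by simp
    ultimately show ?thesis by (simp add: total sumV)
  qed
  ultimately show ?thesis unfolding V_def T_def by blast
qed

section \<open>Points of the circle in coordinates adapted to the pivot\<close>

lemma circle_point_inj:
  assumes "dist c s0 = 1"
    and "circle_point c s0 \<alpha> = circle_point c s0 \<beta>"
  shows "cos \<alpha> = cos \<beta>" and "sin \<alpha> = sin \<beta>"
  using assms by (metis circle_point_coords(1), metis circle_point_coords(2))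

lemma orthonormal_expansion_rot90:
  fixes u v :: "real^2"
  assumes "norm u = 1"
  shows "v = (v \<bullet> u) *\<^sub>R u + (v \<bullet> rot90 u) *\<^sub>R rot90 u"
    and "(norm v)\<^sup>2 = (v \<bullet> u)\<^sup>2 + (v \<bullet> rot90 u)\<^sup>2"
proof -
  have u: "(u$1)\<^sup>2 + (u$2)\<^sup>2 = 1"
    using assms dot_square_norm[of u] by (simp add: inner_vec_def sum_2 power2_eq_square)
  have "v$1 = (v$1 * u$1 + v$2 * u$2) * u$1 + (v$1 * (- u$2) + v$2 * u$1) * (- u$2)"
    "v$2 = (v$1 * u$1 + v$2 * u$2) * u$2 + (v$1 * (- u$2) + v$2 * u$1) * u$1"
    using u by algebra+
  then show "v = (v \<bullet> u) *\<^sub>R u + (v \<bullet> rot90 u) *\<^sub>R rot90 u"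
    by (simp add: vec_eq_iff forall_2 rot90_def inner_vec_def sum_2)
  have "(v$1)\<^sup>2 + (v$2)\<^sup>2
      = (v$1 * u$1 + v$2 * u$2)\<^sup>2 + (v$1 * (- u$2) + v$2 * u$1)\<^sup>2"
    using u by algebra
  then show "(norm v)\<^sup>2 = (v \<bullet> u)\<^sup>2 + (v \<bullet> rot90 u)\<^sup>2"
    unfolding power2_norm_eq_inner by (simp add: rot90_def inner_vec_def sum_2 power2_eq_square)
qed

lemma sphere_point_off_axis_cases:
  assumes c: "dist c s0 = 1" and p: "dist c p = 1" and off: "p \<notin> affine hull {c, s0}"
  obtains \<theta> where "0 < \<theta>" "\<theta> < pi" "p = circle_point c s0 \<theta> \<or> p = circle_point c s0 (- \<theta>)"
proof -
  define u where "u = s0 - c"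
  have u: "norm u = 1" using c by (simp add: u_def dist_norm norm_minus_commute)
  define x y where "x = (p - c) \<bullet> u" and "y = (p - c) \<bullet> rot90 u"
  have pxy: "p = c + x *\<^sub>R u + y *\<^sub>R rot90 u"
    using orthonormal_expansion_rot90(1)[OF u, of "p - c"] by (simp add: x_def y_def algebra_simps)
  have "norm (p - c) = 1" using p by (simp add: dist_norm norm_minus_commute)
  then have xy: "x\<^sup>2 + y\<^sup>2 = 1"
    using orthonormal_expansion_rot90(2)[OF u, of "p - c"] by (simp add: x_def y_def)
  have y0: "y \<noteq> 0"
  proof
    assume "y = 0"
    then have "p = (1 - x) *\<^sub>R c + x *\<^sub>R s0" using pxy by (simp add: u_def algebra_simps)
    moreover have "(1 - x) + x = 1" by simp
    ultimately have "p \<in> affine hull {c, s0}" unfolding affine_hull_2 by blast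
    with off show False by blast
  qed
  have "x\<^sup>2 + \<bar>y\<bar>\<^sup>2 = 1" using xy by simp
  from sincos_total_pi[OF abs_ge_zero this]
  obtain t where t: "0 \<le> t" "t \<le> pi" "x = cos t" "\<bar>y\<bar> = sin t" by blast
  have "t \<noteq> 0" "t \<noteq> pi" using t(4) y0 by auto
  then have strict: "0 < t" "t < pi" using t by auto
  have "p = circle_point c s0 t \<or> p = circle_point c s0 (- t)"
  proof (cases "y > 0")
    case True
    then show ?thesis using pxy t by (simp add: circle_point_def u_def)
  next
    case False
    then have "y = - sin t" using t(4) by simp
    then show ?thesis using pxy t(3) by (simp add: circle_point_def u_def)
  qed
  with strict show thesis by (rule that)
qed

lemma reflect_circle_point:
  assumes "dist c s0 = 1"
  shows "reflect_about_line c s0 (circle_point c s0 \<theta>) = circle_point c s0 (- \<theta>)"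
proof -
  have "(s0 - c) \<bullet> (s0 - c) = 1"
    using assms by (simp add: dist_norm norm_minus_commute dot_square_norm)
  then have "reflect_about_line c s0 (circle_point c s0 \<theta>)
      = c + (2 * cos \<theta>) *\<^sub>R (s0 - c) - (circle_point c s0 \<theta> - c)"
    by (simp add: reflect_about_line_def circle_point_coords(1)[OF assms])
  also have "\<dots> = c + (cos \<theta> *\<^sub>R (s0 - c) + cos \<theta> *\<^sub>R (s0 - c)) - (circle_point c s0 \<theta> - c)"
    by (simp only: mult_2 scaleR_left_distrib)
  also have "\<dots> = circle_point c s0 (- \<theta>)"
    by (simp add: circle_point_def)
  finally show ?thesis .
qed

text \<open>The chord from angle \<open>0\<close> to angle \<open>\<theta>\<close> has length \<open>2 * sin (\<theta> / 2)\<close>, and the half-angle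
  formulas show that it is perpendicular to the direction of angle \<open>\<theta> / 2\<close>.\<close>

lemma sgn_circle_point_diff:
  assumes c: "dist c s0 = 1" and \<theta>: "0 < \<theta>" "\<theta> < 2 * pi"
  shows "sgn (circle_point c s0 \<theta> - s0)
           = - sin (\<theta> / 2) *\<^sub>R (s0 - c) + cos (\<theta> / 2) *\<^sub>R rot90 (s0 - c)"
    and "sgn (circle_point c s0 (- \<theta>) - s0)
           = - sin (\<theta> / 2) *\<^sub>R (s0 - c) - cos (\<theta> / 2) *\<^sub>R rot90 (s0 - c)"
proof -
  define u where "u = s0 - c"
  have n: "u \<bullet> u = 1"
    using c by (simp add: u_def dist_norm norm_minus_commute dot_square_norm)
  have o: "rot90 u \<bullet> u = 0" "u \<bullet> rot90 u = 0" and r: "rot90 u \<bullet> rot90 u = 1"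
    using n by (simp_all add: rot90_def inner_vec_def sum_2 algebra_simps)
  have pos: "sin (\<theta> / 2) > 0" using \<theta> by (intro sin_gt_zero) auto
  have h: "cos \<theta> - 1 = 2 * sin (\<theta> / 2) * - sin (\<theta> / 2)"
    "sin \<theta> = 2 * sin (\<theta> / 2) * cos (\<theta> / 2)"
    using cos_double_sin[of "\<theta> / 2"] sin_double[of "\<theta> / 2"] by (simp_all add: power2_eq_square)
  \<comment> \<open>The sign \<open>e\<close> selects the point itself (\<open>1\<close>) or its mirror image (\<open>- 1\<close>).\<close>
  have one: "norm (- sin (\<theta> / 2) *\<^sub>R u + (e * cos (\<theta> / 2)) *\<^sub>R rot90 u) = 1" if "e\<^sup>2 = 1" for e
  proof -
    let ?w = "- sin (\<theta> / 2) *\<^sub>R u + (e * cos (\<theta> / 2)) *\<^sub>R rot90 u"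
    have "?w \<bullet> ?w = (sin (\<theta> / 2))\<^sup>2 + e\<^sup>2 * (cos (\<theta> / 2))\<^sup>2"
      by (simp add: inner_add_left inner_add_right inner_diff_left inner_diff_right
            n o r power2_eq_square)
    also have "\<dots> = 1" using that by simp
    finally show ?thesis by (simp add: norm_eq_1)
  qed
  have diff: "c + cos \<theta> *\<^sub>R u + (e * sin \<theta>) *\<^sub>R rot90 u - s0
      = (2 * sin (\<theta> / 2)) *\<^sub>R (- sin (\<theta> / 2) *\<^sub>R u + (e * cos (\<theta> / 2)) *\<^sub>R rot90 u)" for e
  proof -
    have "c + cos \<theta> *\<^sub>R u + (e * sin \<theta>) *\<^sub>R rot90 u - s0
        = (cos \<theta> - 1) *\<^sub>R u + (e * sin \<theta>) *\<^sub>R rot90 u"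
      by (simp add: u_def algebra_simps)
    then show ?thesis by (simp only: h scaleR_add_right scaleR_scaleR mult_ac)
  qed
  have sgn: "sgn (c + cos \<theta> *\<^sub>R u + (e * sin \<theta>) *\<^sub>R rot90 u - s0)
      = - sin (\<theta> / 2) *\<^sub>R u + (e * cos (\<theta> / 2)) *\<^sub>R rot90 u" if "e\<^sup>2 = 1" for e
    unfolding diff sgn_scaleR using pos one[OF that]
    by (simp only: sgn_div_norm[of "_ + _"]) simp
  show "sgn (circle_point c s0 \<theta> - s0)
      = - sin (\<theta> / 2) *\<^sub>R (s0 - c) + cos (\<theta> / 2) *\<^sub>R rot90 (s0 - c)"
    using sgn[of 1] by (simp add: circle_point_def u_def)
  show "sgn (circle_point c s0 (- \<theta>) - s0)
      = - sin (\<theta> / 2) *\<^sub>R (s0 - c) - cos (\<theta> / 2) *\<^sub>R rot90 (s0 - c)"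
    using sgn[of "- 1"] by (simp add: circle_point_def u_def)
qed

section \<open>Reflection symmetric sets\<close>

lemma reflection_symmetric_dist_pivot:
  assumes "reflection_symmetric c S s0"
  shows "dist c s0 = 1"
  using assms by (auto simp: reflection_symmetric_def)

lemma reflection_symmetric_minus_pivot:
  assumes rs: "reflection_symmetric c S s0"
  shows "S - {s0} = circle_point c s0 ` upper_angles c S s0
                      \<union> (\<lambda>\<theta>. circle_point c s0 (- \<theta>)) ` upper_angles c S s0"
proof -
  have c: "dist c s0 = 1" using rs by (rule reflection_symmetric_dist_pivot)
  have on: "dist c s = 1" if "s \<in> S" for s
    using rs that by (auto simp: reflection_symmetric_def)
  have off: "s \<notin> affine hull {c, s0}" if "s \<in> S - {s0}" for s
    using rs that by (auto simp: reflection_symmetric_def)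
  have mirror: "circle_point c s0 (- \<theta>) \<in> S - {s0}" if "circle_point c s0 \<theta> \<in> S - {s0}" for \<theta>
    using rs that by (auto simp: reflection_symmetric_def reflect_circle_point[OF c, symmetric])
  have s0: "circle_point c s0 0 = s0" by (simp add: circle_point_def)
  have ne: "circle_point c s0 \<theta> \<noteq> s0" if "0 < \<theta>" "\<theta> < pi" for \<theta>
  proof
    assume "circle_point c s0 \<theta> = s0"
    then have "sin \<theta> = sin 0" using circle_point_inj(2)[OF c, of \<theta> 0] s0 by simp
    with sin_gt_zero[OF that] show False by simp
  qed
  show ?thesis
  proof (intro equalityI subsetI)
    fix s assume s: "s \<in> S - {s0}"
    then obtain \<theta> where \<theta>: "0 < \<theta>" "\<theta> < pi"
      and "s = circle_point c s0 \<theta> \<or> s = circle_point c s0 (- \<theta>)"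
      using sphere_point_off_axis_cases[OF c on off] by blast
    then consider "s = circle_point c s0 \<theta>" | "s = circle_point c s0 (- \<theta>)" by blast
    then show "s \<in> circle_point c s0 ` upper_angles c S s0
        \<union> (\<lambda>\<theta>. circle_point c s0 (- \<theta>)) ` upper_angles c S s0"
    proof cases
      case 1
      then show ?thesis using s \<theta> by (auto simp: upper_angles_def)
    next
      case 2
      then have "\<theta> \<in> upper_angles c S s0"
        using mirror[of "- \<theta>"] s \<theta> by (auto simp: upper_angles_def)
      then show ?thesis using 2 by blast
    qed
  next
    fix s assume "s \<in> circle_point c s0 ` upper_angles c S s0
        \<union> (\<lambda>\<theta>. circle_point c s0 (- \<theta>)) ` upper_angles c S s0"
    then show "s \<in> S - {s0}" using mirror ne by (auto simp: upper_angles_def)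
  qed
qed

text \<open>The sum is taken over mirror pairs: in each pair the components across the axis cancel and
  the components along it double.\<close>

lemma sum_sgn_reflection_symmetric:
  assumes rs: "reflection_symmetric c S s0" and fin: "finite S"
  shows "(\<Sum>s\<in>S - {s0}. sgn (s - s0))
           = - (2 * (\<Sum>\<theta>\<in>upper_angles c S s0. sin (\<theta> / 2))) *\<^sub>R (s0 - c)"
proof -
  define A where "A = upper_angles c S s0"
  define f where "f = circle_point c s0"
  have c: "dist c s0 = 1" using rs by (rule reflection_symmetric_dist_pivot)
  have A: "0 < \<theta>" "\<theta> < pi" if "\<theta> \<in> A" for \<theta>
    using that by (auto simp: A_def upper_angles_def)
  have S: "S - {s0} = f ` A \<union> (\<lambda>\<theta>. f (- \<theta>)) ` A"
    unfolding A_def f_def by (rule reflection_symmetric_minus_pivot[OF rs])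
  have eqI: "\<alpha> = \<beta>" if "\<alpha> \<in> A" "\<beta> \<in> A" "cos \<alpha> = cos \<beta>" for \<alpha> \<beta>
    using A[OF that(1)] A[OF that(2)] that(3) by (simp add: cos_inj_pi)
  have inj: "inj_on f A" "inj_on (\<lambda>\<theta>. f (- \<theta>)) A"
  proof -
    show "inj_on f A"
    proof (rule inj_onI)
      fix \<alpha> \<beta> assume "\<alpha> \<in> A" "\<beta> \<in> A" "f \<alpha> = f \<beta>"
      then show "\<alpha> = \<beta>" using eqI circle_point_inj(1)[OF c] unfolding f_def by blast
    qed
    show "inj_on (\<lambda>\<theta>. f (- \<theta>)) A"
    proof (rule inj_onI)
      fix \<alpha> \<beta> assume ab: "\<alpha> \<in> A" "\<beta> \<in> A" and eq: "f (- \<alpha>) = f (- \<beta>)"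
      have "cos (- \<alpha>) = cos (- \<beta>)" using eq unfolding f_def by (rule circle_point_inj(1)[OF c])
      then show "\<alpha> = \<beta>" using eqI ab by simp
    qed
  qed
  have disj: "f ` A \<inter> (\<lambda>\<theta>. f (- \<theta>)) ` A = {}"
  proof -
    have "f \<alpha> \<noteq> f (- \<beta>)" if "\<alpha> \<in> A" "\<beta> \<in> A" for \<alpha> \<beta>
    proof
      assume "f \<alpha> = f (- \<beta>)"
      then have "sin \<alpha> = sin (- \<beta>)" unfolding f_def by (rule circle_point_inj(2)[OF c])
      then have "sin \<alpha> = - sin \<beta>" by simp
      moreover have "sin \<alpha> > 0" "sin \<beta> > 0" using A that by (simp_all add: sin_gt_zero)
      ultimately show False by simp
    qed
    then show ?thesis by blast
  qed
  have finA: "finite (f ` A)" "finite ((\<lambda>\<theta>. f (- \<theta>)) ` A)"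
    using fin S by (metis finite_Diff finite_Un)+
  have "(\<Sum>s\<in>S - {s0}. sgn (s - s0)) = (\<Sum>\<theta>\<in>A. sgn (f \<theta> - s0)) + (\<Sum>\<theta>\<in>A. sgn (f (- \<theta>) - s0))"
    unfolding S sum.union_disjoint[OF finA disj]
    using inj by (simp add: sum.reindex)
  also have "\<dots> = (\<Sum>\<theta>\<in>A. sgn (f \<theta> - s0) + sgn (f (- \<theta>) - s0))"
    by (rule sum.distrib[symmetric])
  also have "\<dots> = (\<Sum>\<theta>\<in>A. (- 2 * sin (\<theta> / 2)) *\<^sub>R (s0 - c))"
  proof (rule sum.cong[OF refl])
    fix \<theta> assume "\<theta> \<in> A"
    then have "0 < \<theta>" "\<theta> < 2 * pi" using A[of \<theta>] by auto
    then have "sgn (f \<theta> - s0) + sgn (f (- \<theta>) - s0)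
        = (- sin (\<theta> / 2)) *\<^sub>R (s0 - c) + (- sin (\<theta> / 2)) *\<^sub>R (s0 - c)"
      unfolding f_def by (simp add: sgn_circle_point_diff[OF c])
    also have "\<dots> = (- 2 * sin (\<theta> / 2)) *\<^sub>R (s0 - c)"
      by (simp only: scaleR_left_distrib[symmetric]) simp
    finally show "sgn (f \<theta> - s0) + sgn (f (- \<theta>) - s0) = (- 2 * sin (\<theta> / 2)) *\<^sub>R (s0 - c)" .
  qed
  also have "\<dots> = - (2 * (\<Sum>\<theta>\<in>A. sin (\<theta> / 2))) *\<^sub>R (s0 - c)"
    by (simp only: scaleR_left.sum[symmetric] sum_distrib_left[symmetric]) simp
  finally show ?thesis unfolding A_def .
qed

text \<open>A mirror pair spans a line perpendicular to the axis, and the pivot has a different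
  coordinate along the axis.\<close>

lemma reflection_symmetric_not_collinear:
  assumes rs: "reflection_symmetric c S s0" and ne: "S \<noteq> {s0}"
  shows "\<not> collinear S"
proof
  assume "collinear S"
  have c: "dist c s0 = 1" using rs by (rule reflection_symmetric_dist_pivot)
  have s0: "s0 \<in> S" using rs by (simp add: reflection_symmetric_def)
  then have "S - {s0} \<noteq> {}" using ne by blast
  then have "upper_angles c S s0 \<noteq> {}"
    unfolding reflection_symmetric_minus_pivot[OF rs] by simp
  then obtain \<theta> where up: "\<theta> \<in> upper_angles c S s0" by blast
  then have \<theta>: "0 < \<theta>" "\<theta> < pi" by (simp_all add: upper_angles_def)
  define p q where "p = circle_point c s0 \<theta>" and "q = circle_point c s0 (- \<theta>)"
  have "p \<in> S - {s0}" "q \<in> S - {s0}"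
    unfolding p_def q_def reflection_symmetric_minus_pivot[OF rs] using up by simp_all
  then have pS: "p \<in> S" and qS: "q \<in> S" by simp_all
  obtain v where v: "\<And>x y. x \<in> S \<Longrightarrow> y \<in> S \<Longrightarrow> \<exists>k. x - y = k *\<^sub>R v"
    using \<open>collinear S\<close> unfolding collinear_def by metis
  obtain k l where k: "p - q = k *\<^sub>R v" and l: "p - s0 = l *\<^sub>R v"
    using v[OF pS qS] v[OF pS s0] by blast
  have "(p - q) \<bullet> (s0 - c) = (p - c) \<bullet> (s0 - c) - (q - c) \<bullet> (s0 - c)"
    by (simp add: inner_diff_left)
  also have "\<dots> = 0"
    unfolding p_def q_def by (simp add: circle_point_coords(1)[OF c])
  finally have pq: "k * (v \<bullet> (s0 - c)) = 0" by (simp add: k)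
  have "(s0 - c) \<bullet> (s0 - c) = 1"
    using c by (simp add: dist_norm norm_minus_commute dot_square_norm)
  then have "(p - s0) \<bullet> (s0 - c) = cos \<theta> - 1"
    using circle_point_coords(1)[OF c, of \<theta>] unfolding p_def by (simp add: inner_diff_left)
  then have ps: "l * (v \<bullet> (s0 - c)) = cos \<theta> - 1" by (simp add: l)
  have "cos \<theta> < cos 0" using \<theta> by (intro cos_monotone_0_pi) auto
  then have "k = 0" using pq ps by auto
  then have "p = q" using k by simp
  then have "sin \<theta> = sin (- \<theta>)" unfolding p_def q_def by (rule circle_point_inj(2)[OF c])
  with sin_gt_zero[OF \<theta>] show False unfolding sin_minus by linarith
qed

theorem theorem3:
  fixes m :: nat and c s0 :: "real^2" and S :: "(real^2) set"
  assumes "m \<ge> 1"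
    and "card S = 2 * m + 1"
    and "reflection_symmetric c S s0"
  shows "fermat_weber_point S = s0 \<longleftrightarrow> condition_A c S s0"
proof -
  have fin: "finite S" using assms(2) by (metis card.infinite add_is_0 one_neq_zero)
  have "S \<noteq> {s0}" using assms(1,2) by auto
  then have nc: "\<not> collinear S" by (rule reflection_symmetric_not_collinear[OF assms(3)])
  have s0: "s0 \<in> S" using assms(3) by (simp add: reflection_symmetric_def)
  have c: "norm (s0 - c) = 1"
    using reflection_symmetric_dist_pivot[OF assms(3)] by (simp add: dist_norm norm_minus_commute)
  have pos: "0 \<le> (\<Sum>\<theta>\<in>upper_angles c S s0. sin (\<theta> / 2))"
    by (intro sum_nonneg sin_ge_zero) (auto simp: upper_angles_def)
  have "fermat_weber_point S = s0 \<longleftrightarrow> minimizes_dist_sum S s0"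
    unfolding fermat_weber_point_def
    using minimizes_dist_sum_ex1[OF fin nc] by (metis theI')
  also have "\<dots> \<longleftrightarrow> norm (\<Sum>s\<in>S - {s0}. sgn (s - s0)) \<le> 1"
    unfolding minimizes_dist_sum_def dist_sum_def
    by (rule sum_dist_minimal_at_point_iff[OF fin s0])
  also have "\<dots> \<longleftrightarrow> condition_A c S s0"
    unfolding sum_sgn_reflection_symmetric[OF assms(3) fin] condition_A_def
    using pos c by simp
  finally show ?thesis .
qed

end
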